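(* (Fundamental Theorem of Logical Relation.) Let $(\mathsf{J}\mathbb{N},\eta,\kappa)$ be a nucleus relative to System $\mathsf{T}$. Let ${\mathrel{R}_{\mathbb{N}}} \subseteq \mathbb{N} \times \mathsf{J}\mathbb{N}$ be a binary relation, and extend it to relations ${\mathrel{R}_{\rho}} \subseteq \rho \times \rho^\mathsf{J}$ for every type $\rho$ of $\mathsf{T}$ by \[ f \mathrel{R}_{\sigma\to\tau} g \;:\Longleftrightarrow\; \forall x^{\sigma}\, a^{\sigma^\mathsf{J}} \left( x \mathrel{R}_{\sigma} a \to fx \mathrel{R}_{\tau} ga \right). \] Suppose that \[ \forall n^\mathbb{N} \left( n \mathrel{R}_{\mathbb{N}} \eta n \right) \qquad\text{and}\qquad \forall f^{\mathbb{N}\to\mathbb{N}}\, g^{\mathbb{N}\to\mathsf{J}\mathbb{N}} \left( \forall n^\mathbb{N} \left(fn \mathrel{R}_{\mathbb{N}} gn\right) \to f \mathrel{R}_{\mathbb{N}\to\mathbb{N}} \kappa g \right). \] Then $t \mathrel{R}_\rho t^\mathsf{J}$ for every closed term $t:\rho$ of $\mathsf{T}$.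
   Context: Gödel's System $\mathsf{T}$: types are generated by $\sigma,\tau ::= \mathbb{N} \mid \sigma\to\tau$; terms by $t,u ::= x \mid \lambda x^\sigma.t \mid tu \mid 0 \mid \mathsf{suc} \mid \mathsf{rec}_\sigma$, with the usual simply-typed typing rules, $0:\mathbb{N}$, $\mathsf{suc}:\mathbb{N}\to\mathbb{N}$, $\mathsf{rec}_\sigma : \sigma \to (\mathbb{N}\to\sigma\to\sigma)\to\mathbb{N}\to\sigma$, and computation rules $\mathsf{rec}_\sigma(a,f,0)=a$, $\mathsf{rec}_\sigma(a,f,\mathsf{suc}\,n)=f(n,\mathsf{rec}_\sigma(a,f,n))$. We write $f(a_1,\dots,a_n)$ for iterated application and $f\circ g$ for $\lambda x.f(gx)$. Objects of a type are its (standard) interpretations/values; quantifiers $\forall x^\sigma$ range over objects of type $\sigma$. A nucleus relative to $\mathsf{T}$ is a triple $(\mathsf{J}\mathbb{N},\eta,\kappa)$ of a type $\mathsf{J}\mathbb{N}$ of $\mathsf{T}$ and two terms $\eta:\mathbb{N}\to\mathsf{J}\mathbb{N}$, $\kappa:(\mathbb{N}\to\mathsf{J}\mathbb{N})\to\mathsf{J}\mathbb{N}\to\mathsf{J}\mathbb{N}$ of $\mathsf{T}$ (no monad laws are required). The $\mathsf{J}$-translation: on types, $\mathbb{N}^\mathsf{J}:=\mathsf{J}\mathbb{N}$ and $(\sigma\to\tau)^\mathsf{J}:=\sigma^\mathsf{J}\to\tau^\mathsf{J}$. A term $\Gamma\vdash t:\rho$ is translated to $\Gamma^\mathsf{J}\vdash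 t^\mathsf{J}:\rho^\mathsf{J}$, where each variable $x:\sigma$ of $\Gamma$ is replaced by a fresh $x^\mathsf{J}:\sigma^\mathsf{J}$, and: $(x)^\mathsf{J}:=x^\mathsf{J}$; $(\lambda x.t)^\mathsf{J}:=\lambda x^\mathsf{J}.t^\mathsf{J}$; $(tu)^\mathsf{J}:=t^\mathsf{J}u^\mathsf{J}$; $0^\mathsf{J}:=\eta\,0$; $\mathsf{suc}^\mathsf{J}:=\kappa(\eta\circ\mathsf{suc})$; $(\mathsf{rec}_\sigma)^\mathsf{J}:=\lambda x^{\sigma^\mathsf{J}} f^{\mathsf{J}\mathbb{N}\to\sigma^\mathsf{J}\to\sigma^\mathsf{J}}.\,\mathrm{ke}_\sigma(\mathsf{rec}_{\sigma^\mathsf{J}}(x,f\circ\eta))$, where $\mathrm{ke}_\sigma:(\mathbb{N}\to\sigma^\mathsf{J})\to\mathsf{J}\mathbb{N}\to\sigma^\mathsf{J}$ is defined by induction on $\sigma$: $\mathrm{ke}_\mathbb{N}:=\kappa$ and $\mathrm{ke}_{\sigma\to\tau}:=\lambda g^{\mathbb{N}\to\sigma^\mathsf{J}\to\tau^\mathsf{J}} a^{\mathsf{J}\mathbb{N}} x^{\sigma^\mathsf{J}}.\,\mathrm{ke}_\tau(\lambda n^\mathbb{N}.g(n,x),a)$. *)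

theory Defs
  imports Main
begin

datatype ty = N | Arrow ty ty  (infixr "\<rightarrow>\<^sub>T" 65)

text \<open>Variables are de Bruijn indices: the context (and the environment, below) is a list whose
  head belongs to the innermost binder.\<close>

datatype tm = Var nat | Lam ty tm | App tm tm  (infixl "\<cdot>" 200) | Zero | Succ | Rec ty

inductive typing :: "ty list \<Rightarrow> tm \<Rightarrow> ty \<Rightarrow> bool"  ("_ \<turnstile> _ : _" [50, 50, 50] 50) where
  Var: "i < length \<Gamma> \<Longrightarrow> \<Gamma> \<turnstile> Var i : \<Gamma> ! i"
| Lam: "\<sigma> # \<Gamma> \<turnstile> t : \<tau> \<Longrightarrow> \<Gamma> \<turnstile> Lam \<sigma> t : \<sigma> \<rightarrow>\<^sub>T \<tau>"
| App: "\<Gamma> \<turnstile> t : \<sigma> \<rightarrow>\<^sub>T \<tau> \<Longrightarrow> \<Gamma> \<turnstile> u : \<sigma> \<Longrightarrow> \<Gamma> \<turnstile> t \<cdot> u : \<tau>"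
| Zero: "\<Gamma> \<turnstile> Zero : N"
| Succ: "\<Gamma> \<turnstile> Succ : N \<rightarrow>\<^sub>T N"
| Rec: "\<Gamma> \<turnstile> Rec \<sigma> : \<sigma> \<rightarrow>\<^sub>T (N \<rightarrow>\<^sub>T \<sigma> \<rightarrow>\<^sub>T \<sigma>) \<rightarrow>\<^sub>T N \<rightarrow>\<^sub>T \<sigma>"

definition nucleus :: "ty \<Rightarrow> tm \<Rightarrow> tm \<Rightarrow> bool" where
  "nucleus JN \<eta> \<kappa> \<longleftrightarrow>
     [] \<turnstile> \<eta> : N \<rightarrow>\<^sub>T JN \<and> [] \<turnstile> \<kappa> : (N \<rightarrow>\<^sub>T JN) \<rightarrow>\<^sub>T JN \<rightarrow>\<^sub>T JN"

fun Jty :: "ty \<Rightarrow> ty \<Rightarrow> ty" where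
  "Jty JN N = JN"
| "Jty JN (\<sigma> \<rightarrow>\<^sub>T \<tau>) = Jty JN \<sigma> \<rightarrow>\<^sub>T Jty JN \<tau>"

text \<open>The terms \<open>\<eta>\<close> and \<open>\<kappa>\<close> of a nucleus are closed, so no index shifting is needed when they are
  placed under binders. The bodies below are, with names,
  \<open>\<lambda>g a x. ke\<^sub>\<tau> (\<lambda>n. g n x) a\<close> and, in the case of \<open>Rec\<close>, \<open>\<lambda>x f. ke\<^sub>\<sigma> (rec x (\<lambda>n. f (\<eta> n)))\<close>.\<close>

fun ke :: "ty \<Rightarrow> tm \<Rightarrow> ty \<Rightarrow> tm" where
  "ke JN \<kappa> N = \<kappa>"
| "ke JN \<kappa> (\<sigma> \<rightarrow>\<^sub>T \<tau>) =
     Lam (N \<rightarrow>\<^sub>T Jty JN \<sigma> \<rightarrow>\<^sub>T Jty JN \<tau>) (Lam JN (Lam (Jty JN \<sigma>)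
       (ke JN \<kappa> \<tau> \<cdot> Lam N (Var 3 \<cdot> Var 0 \<cdot> Var 1) \<cdot> Var 1)))"

fun Jtm :: "ty \<Rightarrow> tm \<Rightarrow> tm \<Rightarrow> tm \<Rightarrow> tm" where
  "Jtm JN \<eta> \<kappa> (Var i) = Var i"
| "Jtm JN \<eta> \<kappa> (Lam \<sigma> t) = Lam (Jty JN \<sigma>) (Jtm JN \<eta> \<kappa> t)"
| "Jtm JN \<eta> \<kappa> (t \<cdot> u) = Jtm JN \<eta> \<kappa> t \<cdot> Jtm JN \<eta> \<kappa> u"
| "Jtm JN \<eta> \<kappa> Zero = \<eta> \<cdot> Zero"
| "Jtm JN \<eta> \<kappa> Succ = \<kappa> \<cdot> Lam N (\<eta> \<cdot> (Succ \<cdot> Var 0))"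
| "Jtm JN \<eta> \<kappa> (Rec \<sigma>) =
     Lam (Jty JN \<sigma>) (Lam (JN \<rightarrow>\<^sub>T Jty JN \<sigma> \<rightarrow>\<^sub>T Jty JN \<sigma>)
       (ke JN \<kappa> \<sigma> \<cdot> (Rec (Jty JN \<sigma>) \<cdot> Var 1 \<cdot> Lam N (Var 1 \<cdot> (\<eta> \<cdot> Var 0)))))"

text \<open>The full set-theoretic hierarchy over all finite types does not fit into a single HOL type.
  The objects are therefore taken from an arbitrary extensional type structure \<open>M\<close> in which the
  base type consists of exactly the natural numbers and which interprets all terms of System T;
  \<open>obj M \<sigma>\<close> is the set of objects of type \<open>\<sigma>\<close>. Whenever a full structure exists it is a special
  case (lemma \<open>full_structure_T_model\<close>); other instances are the hereditarily effective and the
  continuous functionals, and closed terms modulo extensional equality.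

  Application is not indexed by types, so an object that lies in several carriers acts in the
  same way in each of them; tagging the objects with their types makes the carriers disjoint.\<close>

record 'v type_structure =
  obj :: "ty \<Rightarrow> 'v set"
  app :: "'v \<Rightarrow> 'v \<Rightarrow> 'v"
  num :: "nat \<Rightarrow> 'v"

definition type_structure :: "'v type_structure \<Rightarrow> bool" where
  "type_structure M \<longleftrightarrow>
     bij_betw (num M) UNIV (obj M N) \<and>
     (\<forall>\<sigma> \<tau>. \<forall>f \<in> obj M (\<sigma> \<rightarrow>\<^sub>T \<tau>). \<forall>x \<in> obj M \<sigma>. app M f x \<in> obj M \<tau>) \<and>
     (\<forall>\<sigma> \<tau>. \<forall>f \<in> obj M (\<sigma> \<rightarrow>\<^sub>T \<tau>). \<forall>g \<in> obj M (\<sigma> \<rightarrow>\<^sub>T \<tau>).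
        (\<forall>x \<in> obj M \<sigma>. app M f x = app M g x) \<longrightarrow> f = g)"

definition is_succ :: "'v type_structure \<Rightarrow> 'v \<Rightarrow> bool" where
  "is_succ M s \<longleftrightarrow> s \<in> obj M (N \<rightarrow>\<^sub>T N) \<and> (\<forall>n. app M s (num M n) = num M (Suc n))"

definition is_rec :: "'v type_structure \<Rightarrow> ty \<Rightarrow> 'v \<Rightarrow> bool" where
  "is_rec M \<sigma> r \<longleftrightarrow>
     r \<in> obj M (\<sigma> \<rightarrow>\<^sub>T (N \<rightarrow>\<^sub>T \<sigma> \<rightarrow>\<^sub>T \<sigma>) \<rightarrow>\<^sub>T N \<rightarrow>\<^sub>T \<sigma>) \<and>
     (\<forall>a \<in> obj M \<sigma>. \<forall>f \<in> obj M (N \<rightarrow>\<^sub>T \<sigma> \<rightarrow>\<^sub>T \<sigma>).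
        app M (app M (app M r a) f) (num M 0) = a \<and>
        (\<forall>n. app M (app M (app M r a) f) (num M (Suc n)) =
             app M (app M f (num M n)) (app M (app M (app M r a) f) (num M n))))"

text \<open>Closure under \<open>\<lambda>\<close>-definability is expressed by the existence of the combinators K and S.\<close>

definition T_model :: "'v type_structure \<Rightarrow> bool" where
  "T_model M \<longleftrightarrow> type_structure M \<and>
     (\<forall>\<sigma> \<tau>. \<exists>k \<in> obj M (\<sigma> \<rightarrow>\<^sub>T \<tau> \<rightarrow>\<^sub>T \<sigma>). \<forall>x \<in> obj M \<sigma>. \<forall>y \<in> obj M \<tau>.
        app M (app M k x) y = x) \<and>
     (\<forall>\<rho> \<sigma> \<tau>. \<exists>s \<in> obj M ((\<rho> \<rightarrow>\<^sub>T \<sigma> \<rightarrow>\<^sub>T \<tau>) \<rightarrow>\<^sub>T (\<rho> \<rightarrow>\<^sub>T \<sigma>) \<rightarrow>\<^sub>T \<rho> \<rightarrow>\<^sub>T \<tau>).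
        \<forall>x \<in> obj M (\<rho> \<rightarrow>\<^sub>T \<sigma> \<rightarrow>\<^sub>T \<tau>). \<forall>y \<in> obj M (\<rho> \<rightarrow>\<^sub>T \<sigma>). \<forall>z \<in> obj M \<rho>.
        app M (app M (app M s x) y) z = app M (app M x z) (app M y z)) \<and>
     (\<exists>s. is_succ M s) \<and> (\<forall>\<sigma>. \<exists>r. is_rec M \<sigma> r)"

text \<open>The value of \<open>t\<close> in context \<open>\<Gamma>\<close> under the environment \<open>e\<close>. In a \<open>T_model\<close> every
  description below denotes, by extensionality, a unique object if the term is well typed.\<close>

fun sem :: "'v type_structure \<Rightarrow> ty list \<Rightarrow> 'v list \<Rightarrow> tm \<Rightarrow> 'v" where
  "sem M \<Gamma> e (Var i) = e ! i"
| "sem M \<Gamma> e (Lam \<sigma> t) =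
     (THE f. \<exists>\<tau>. \<sigma> # \<Gamma> \<turnstile> t : \<tau> \<and> f \<in> obj M (\<sigma> \<rightarrow>\<^sub>T \<tau>) \<and>
        (\<forall>x \<in> obj M \<sigma>. app M f x = sem M (\<sigma> # \<Gamma>) (x # e) t))"
| "sem M \<Gamma> e (t \<cdot> u) = app M (sem M \<Gamma> e t) (sem M \<Gamma> e u)"
| "sem M \<Gamma> e Zero = num M 0"
| "sem M \<Gamma> e Succ = (THE s. is_succ M s)"
| "sem M \<Gamma> e (Rec \<sigma>) = (THE r. is_rec M \<sigma> r)"

abbreviation value_of :: "'v type_structure \<Rightarrow> tm \<Rightarrow> 'v" where
  "value_of M t \<equiv> sem M [] [] t"

fun logical_relation :: "'v type_structure \<Rightarrow> ty \<Rightarrow> ('v \<times> 'v) set \<Rightarrow> ty \<Rightarrow> ('v \<times> 'v) set" where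
  "logical_relation M JN R N = R"
| "logical_relation M JN R (\<sigma> \<rightarrow>\<^sub>T \<tau>) =
     {(f, g). f \<in> obj M (\<sigma> \<rightarrow>\<^sub>T \<tau>) \<and> g \<in> obj M (Jty JN (\<sigma> \<rightarrow>\<^sub>T \<tau>)) \<and>
        (\<forall>x \<in> obj M \<sigma>. \<forall>a \<in> obj M (Jty JN \<sigma>).
           (x, a) \<in> logical_relation M JN R \<sigma> \<longrightarrow> (app M f x, app M g a) \<in> logical_relation M JN R \<tau>)}"

definition full_structure :: "'v type_structure \<Rightarrow> bool" where
  "full_structure M \<longleftrightarrow> type_structure M \<and>
     (\<forall>\<sigma> \<tau> F. (\<forall>x \<in> obj M \<sigma>. F x \<in> obj M \<tau>) \<longrightarrow>
        (\<exists>f \<in> obj M (\<sigma> \<rightarrow>\<^sub>T \<tau>). \<forall>x \<in> obj M \<sigma>. app M f x = F x))"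

context fixes M :: "'v type_structure" assumes full: "full_structure M"
begin

definition fun_obj :: "ty \<Rightarrow> ty \<Rightarrow> ('v \<Rightarrow> 'v) \<Rightarrow> 'v" where
  "fun_obj \<sigma> \<tau> F = (SOME f. f \<in> obj M (\<sigma> \<rightarrow>\<^sub>T \<tau>) \<and> (\<forall>x \<in> obj M \<sigma>. app M f x = F x))"

lemma fun_obj:
  assumes "\<And>x. x \<in> obj M \<sigma> \<Longrightarrow> F x \<in> obj M \<tau>"
  shows "fun_obj \<sigma> \<tau> F \<in> obj M (\<sigma> \<rightarrow>\<^sub>T \<tau>)" "x \<in> obj M \<sigma> \<Longrightarrow> app M (fun_obj \<sigma> \<tau> F) x = F x"
proof -
  have "\<exists>f. f \<in> obj M (\<sigma> \<rightarrow>\<^sub>T \<tau>) \<and> (\<forall>x \<in> obj M \<sigma>. app M f x = F x)"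
    using full assms unfolding full_structure_def by blast
  from someI_ex[OF this] show "fun_obj \<sigma> \<tau> F \<in> obj M (\<sigma> \<rightarrow>\<^sub>T \<tau>)" "x \<in> obj M \<sigma> \<Longrightarrow> app M (fun_obj \<sigma> \<tau> F) x = F x"
    unfolding fun_obj_def by auto
qed

lemma app_obj: "f \<in> obj M (\<sigma> \<rightarrow>\<^sub>T \<tau>) \<Longrightarrow> x \<in> obj M \<sigma> \<Longrightarrow> app M f x \<in> obj M \<tau>"
  using full unfolding full_structure_def type_structure_def by blast

lemma num_bij: "bij_betw (num M) UNIV (obj M N)"
  using full unfolding full_structure_def type_structure_def by blast

lemma num_obj: "num M n \<in> obj M N" using num_bij by (auto simp: bij_betw_def)

definition num_inv :: "'v \<Rightarrow> nat" where "num_inv = inv (num M)"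

lemma num_inv: "num_inv (num M n) = n" using num_bij unfolding num_inv_def bij_betw_def by simp

lemma full_structure_T_model: "T_model M"
proof -
  have K: "\<exists>k \<in> obj M (\<sigma> \<rightarrow>\<^sub>T \<tau> \<rightarrow>\<^sub>T \<sigma>). \<forall>x \<in> obj M \<sigma>. \<forall>y \<in> obj M \<tau>.
        app M (app M k x) y = x" for \<sigma> \<tau>
    by (rule bexI[of _ "fun_obj \<sigma> (\<tau> \<rightarrow>\<^sub>T \<sigma>) (\<lambda>x. fun_obj \<tau> \<sigma> (\<lambda>y. x))"]) (simp_all add: fun_obj)
  have S: "\<exists>s \<in> obj M ((\<rho> \<rightarrow>\<^sub>T \<sigma> \<rightarrow>\<^sub>T \<tau>) \<rightarrow>\<^sub>T (\<rho> \<rightarrow>\<^sub>T \<sigma>) \<rightarrow>\<^sub>T \<rho> \<rightarrow>\<^sub>T \<tau>).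
        \<forall>x \<in> obj M (\<rho> \<rightarrow>\<^sub>T \<sigma> \<rightarrow>\<^sub>T \<tau>). \<forall>y \<in> obj M (\<rho> \<rightarrow>\<^sub>T \<sigma>). \<forall>z \<in> obj M \<rho>.
        app M (app M (app M s x) y) z = app M (app M x z) (app M y z)"
    for \<rho> \<sigma> \<tau>
  proof -
    have 1: "app M (app M x z) (app M y z) \<in> obj M \<tau>"
      if "x \<in> obj M (\<rho> \<rightarrow>\<^sub>T \<sigma> \<rightarrow>\<^sub>T \<tau>)" "y \<in> obj M (\<rho> \<rightarrow>\<^sub>T \<sigma>)" "z \<in> obj M \<rho>" for x y z
      using that app_obj by blast
    show ?thesis
      by (rule bexI[of _ "fun_obj (\<rho> \<rightarrow>\<^sub>T \<sigma> \<rightarrow>\<^sub>T \<tau>) ((\<rho> \<rightarrow>\<^sub>T \<sigma>) \<rightarrow>\<^sub>T \<rho> \<rightarrow>\<^sub>T \<tau>) (\<lambda>x. fun_obj (\<rho> \<rightarrow>\<^sub>T \<sigma>) (\<rho> \<rightarrow>\<^sub>T \<tau>)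
             (\<lambda>y. fun_obj \<rho> \<tau> (\<lambda>z. app M (app M x z) (app M y z))))"]) (simp_all add: fun_obj 1)
  qed
  have Su: "\<exists>s. is_succ M s" unfolding is_succ_def
    by (rule exI[of _ "fun_obj N N (\<lambda>x. num M (Suc (num_inv x)))"]) (simp add: fun_obj num_obj num_inv)
  have R: "\<exists>r. is_rec M \<sigma> r" for \<sigma>
  proof -
    define it where "it a f n = rec_nat a (\<lambda>n y. app M (app M f (num M n)) y) n" for a f n
    have 1: "it a f n \<in> obj M \<sigma>" if "a \<in> obj M \<sigma>" "f \<in> obj M (N \<rightarrow>\<^sub>T \<sigma> \<rightarrow>\<^sub>T \<sigma>)" for a f n
      using that unfolding it_def by (induction n) (auto intro: app_obj num_obj)
    have 2: "it a f 0 = a" "it a f (Suc n) = app M (app M f (num M n)) (it a f n)" for a f n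
      by (simp_all add: it_def)
    show ?thesis unfolding is_rec_def
      by (rule exI[of _ "fun_obj \<sigma> ((N \<rightarrow>\<^sub>T \<sigma> \<rightarrow>\<^sub>T \<sigma>) \<rightarrow>\<^sub>T N \<rightarrow>\<^sub>T \<sigma>) (\<lambda>a. fun_obj (N \<rightarrow>\<^sub>T \<sigma> \<rightarrow>\<^sub>T \<sigma>) (N \<rightarrow>\<^sub>T \<sigma>)
         (\<lambda>f. fun_obj N \<sigma> (\<lambda>x. it a f (num_inv x))))"]) (simp add: fun_obj 1 2 num_obj num_inv)
  qed
  show ?thesis using full K S Su R unfolding T_model_def full_structure_def by blast
qed

end

end

theory Submission
  imports Defs
begin

text \<open>An induction on typing derivations, generalised to open terms in related environments. The
  case of an abstraction requires the set-theoretic \<open>\<lambda>\<close> to exist in the model, which is the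
  combinatory completeness of K and S. The case of \<open>Rec\<close> extends the hypothesis on \<open>\<kappa>\<close> from the
  base type to all types by induction on types, with \<open>ke\<close> in place of \<open>\<kappa>\<close>, and applies it to the
  two recursively defined sequences, which are related pointwise by induction on the naturals.\<close>

section \<open>Typing\<close>

inductive_cases typing_VarE: "\<Gamma> \<turnstile> Var i : \<tau>"
inductive_cases typing_LamE: "\<Gamma> \<turnstile> Lam \<sigma> t : \<tau>"
inductive_cases typing_AppE: "\<Gamma> \<turnstile> t \<cdot> u : \<tau>"
inductive_cases typing_ZeroE: "\<Gamma> \<turnstile> Zero : \<tau>"
inductive_cases typing_SuccE: "\<Gamma> \<turnstile> Succ : \<tau>"
inductive_cases typing_RecE: "\<Gamma> \<turnstile> Rec \<sigma> : \<tau>"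

text \<open>Binders carry their types, so a context and a term leave no choice of type. This fixes
  the existentially quantified codomain in the description that gives the value of an
  abstraction.\<close>

lemma typing_unique: "\<Gamma> \<turnstile> t : \<tau> \<Longrightarrow> \<Gamma> \<turnstile> t : \<tau>' \<Longrightarrow> \<tau> = \<tau>'"
proof (induction arbitrary: \<tau>' rule: typing.induct)
  case (App \<Gamma> t \<sigma> \<tau> u)
  then show ?case by (blast elim: typing_AppE)
qed (blast elim: typing_VarE typing_LamE typing_ZeroE typing_SuccE typing_RecE)+

lemma typing_Var: "i < length \<Gamma> \<Longrightarrow> \<Gamma> ! i = \<tau> \<Longrightarrow> \<Gamma> \<turnstile> Var i : \<tau>"
  using typing.Var by blast

text \<open>The added types stand behind those of \<Gamma>, so every index keeps its meaning, also
  below binders. With \<Gamma> empty this places the closed terms \<open>\<eta>\<close>,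
  \<open>\<kappa>\<close> and \<open>ke\<close> in any context.\<close>

lemma typing_append: "\<Gamma> \<turnstile> t : \<tau> \<Longrightarrow> \<Gamma> @ \<Delta> \<turnstile> t : \<tau>"
proof (induction rule: typing.induct)
  case (Var i \<Gamma>)
  then show ?case by (auto intro!: typing_Var simp: nth_append)
qed (auto intro: typing.intros)

lemma typing_closed: "[] \<turnstile> t : \<tau> \<Longrightarrow> \<Gamma> \<turnstile> t : \<tau>"
  using typing_append[of "[]" t \<tau> \<Gamma>] by simp

section \<open>Typing of the translation\<close>

text \<open>Stated separately because \<open>ke_Arrow_app\<close> uses the typing of this body again
  to evaluate the three abstractions around it.\<close>

lemma typing_ke_body:
  assumes "[] \<turnstile> ke JN \<kappa> \<tau> : (N \<rightarrow>\<^sub>T \<tau>') \<rightarrow>\<^sub>T JN \<rightarrow>\<^sub>T \<tau>'"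
  shows "[\<sigma>', JN, N \<rightarrow>\<^sub>T \<sigma>' \<rightarrow>\<^sub>T \<tau>'] \<turnstile> ke JN \<kappa> \<tau> \<cdot> Lam N (Var 3 \<cdot> Var 0 \<cdot> Var 1) \<cdot> Var 1 : \<tau>'"
  by (rule typing.App typing.Lam typing_closed[OF assms] typing_Var | simp)+

lemma typing_ke:
  assumes "[] \<turnstile> \<kappa> : (N \<rightarrow>\<^sub>T JN) \<rightarrow>\<^sub>T JN \<rightarrow>\<^sub>T JN"
  shows "[] \<turnstile> ke JN \<kappa> \<sigma> : (N \<rightarrow>\<^sub>T Jty JN \<sigma>) \<rightarrow>\<^sub>T JN \<rightarrow>\<^sub>T Jty JN \<sigma>"
proof (induction \<sigma>)
  case N
  then show ?case using assms by simp
next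
  case (Arrow \<sigma> \<tau>)
  show ?case by (auto intro!: typing.Lam typing_ke_body Arrow simp del: One_nat_def)
qed

lemma typing_Jtm:
  assumes "nucleus JN \<eta> \<kappa>"
  shows "\<Gamma> \<turnstile> t : \<tau> \<Longrightarrow> map (Jty JN) \<Gamma> \<turnstile> Jtm JN \<eta> \<kappa> t : Jty JN \<tau>"
proof (induction rule: typing.induct)
  note eta = assms[unfolded nucleus_def, THEN conjunct1]
  note kappa = assms[unfolded nucleus_def, THEN conjunct2]
  {
    case (Var i \<Gamma>)
    then show ?case by (auto intro!: typing_Var)
  next
    case (Zero \<Gamma>)
    show ?case unfolding Jtm.simps Jty.simps
      by (rule typing.App[OF typing_closed[OF eta] typing.Zero])
  next
    case (Succ \<Gamma>)
    show ?case unfolding Jtm.simps Jty.simps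
      by (rule typing.App[OF typing_closed[OF kappa]] typing.Lam
          typing.App[OF typing_closed[OF eta]] typing.App[OF typing.Succ] typing_Var | simp)+
  next
    case (Rec \<Gamma> \<sigma>)
    show ?case unfolding Jtm.simps Jty.simps
      by (rule typing.Lam typing.App[OF typing_closed[OF typing_ke[OF kappa]]]
          typing.App[OF typing_closed[OF eta]] typing.App typing.Rec typing_Var | simp)+
  }
qed (auto intro: typing.intros)

section \<open>Combinatory completeness\<close>

locale T_structure =
  fixes M :: "'v type_structure"
  assumes T_model: "T_model M"
begin

abbreviation app_M  (infixl "\<bullet>" 70) where "f \<bullet> x \<equiv> app M f x"

lemma app_closed: "f \<in> obj M (\<sigma> \<rightarrow>\<^sub>T \<tau>) \<Longrightarrow> x \<in> obj M \<sigma> \<Longrightarrow> f \<bullet> x \<in> obj M \<tau>"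
  using T_model unfolding T_model_def type_structure_def by blast

lemma extensionality:
  assumes "f \<in> obj M (\<sigma> \<rightarrow>\<^sub>T \<tau>)" "g \<in> obj M (\<sigma> \<rightarrow>\<^sub>T \<tau>)" "\<And>x. x \<in> obj M \<sigma> \<Longrightarrow> f \<bullet> x = g \<bullet> x"
  shows "f = g"
  using T_model assms unfolding T_model_def type_structure_def by blast

lemma obj_N: "obj M N = range (num M)"
  using T_model unfolding T_model_def type_structure_def bij_betw_def by simp

lemma K_exists:
  obtains k where "k \<in> obj M (\<sigma> \<rightarrow>\<^sub>T \<tau> \<rightarrow>\<^sub>T \<sigma>)"
    "\<And>x y. x \<in> obj M \<sigma> \<Longrightarrow> y \<in> obj M \<tau> \<Longrightarrow> k \<bullet> x \<bullet> y = x"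
proof -
  have "\<exists>k \<in> obj M (\<sigma> \<rightarrow>\<^sub>T \<tau> \<rightarrow>\<^sub>T \<sigma>). \<forall>x \<in> obj M \<sigma>. \<forall>y \<in> obj M \<tau>. k \<bullet> x \<bullet> y = x"
    using T_model unfolding T_model_def by blast
  then show thesis using that by blast
qed

lemma S_exists:
  obtains s where "s \<in> obj M ((\<rho> \<rightarrow>\<^sub>T \<sigma> \<rightarrow>\<^sub>T \<tau>) \<rightarrow>\<^sub>T (\<rho> \<rightarrow>\<^sub>T \<sigma>) \<rightarrow>\<^sub>T \<rho> \<rightarrow>\<^sub>T \<tau>)"
    "\<And>x y z. x \<in> obj M (\<rho> \<rightarrow>\<^sub>T \<sigma> \<rightarrow>\<^sub>T \<tau>) \<Longrightarrow> y \<in> obj M (\<rho> \<rightarrow>\<^sub>T \<sigma>) \<Longrightarrow> z \<in> obj M \<rho> \<Longrightarrow>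
       s \<bullet> x \<bullet> y \<bullet> z = x \<bullet> z \<bullet> (y \<bullet> z)"
proof -
  have "\<exists>s \<in> obj M ((\<rho> \<rightarrow>\<^sub>T \<sigma> \<rightarrow>\<^sub>T \<tau>) \<rightarrow>\<^sub>T (\<rho> \<rightarrow>\<^sub>T \<sigma>) \<rightarrow>\<^sub>T \<rho> \<rightarrow>\<^sub>T \<tau>).
      \<forall>x \<in> obj M (\<rho> \<rightarrow>\<^sub>T \<sigma> \<rightarrow>\<^sub>T \<tau>). \<forall>y \<in> obj M (\<rho> \<rightarrow>\<^sub>T \<sigma>). \<forall>z \<in> obj M \<rho>.
        s \<bullet> x \<bullet> y \<bullet> z = x \<bullet> z \<bullet> (y \<bullet> z)"
    using T_model unfolding T_model_def by blast
  then show thesis using that by blast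
qed

text \<open>The identity is S K K: \<open>s \<bullet> k \<bullet> k' \<bullet> x = k \<bullet> x
  \<bullet> (k' \<bullet> x) = x\<close>. The types of \<open>k\<close> are chosen so that it
  discards \<open>k' \<bullet> x\<close>, an object of type
  \<open>\<sigma> \<rightarrow>\<^sub>T \<sigma>\<close>.\<close>

lemma I_exists:
  obtains i where "i \<in> obj M (\<sigma> \<rightarrow>\<^sub>T \<sigma>)" "\<And>x. x \<in> obj M \<sigma> \<Longrightarrow> i \<bullet> x = x"
proof -
  obtain k where k: "k \<in> obj M (\<sigma> \<rightarrow>\<^sub>T (\<sigma> \<rightarrow>\<^sub>T \<sigma>) \<rightarrow>\<^sub>T \<sigma>)"
    "\<And>x y. x \<in> obj M \<sigma> \<Longrightarrow> y \<in> obj M (\<sigma> \<rightarrow>\<^sub>T \<sigma>) \<Longrightarrow> k \<bullet> x \<bullet> y = x"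
    using K_exists[of \<sigma> "\<sigma> \<rightarrow>\<^sub>T \<sigma>"] by blast
  obtain k' where k': "k' \<in> obj M (\<sigma> \<rightarrow>\<^sub>T \<sigma> \<rightarrow>\<^sub>T \<sigma>)" using K_exists[of \<sigma> \<sigma>] by blast
  obtain s where s: "s \<in> obj M ((\<sigma> \<rightarrow>\<^sub>T (\<sigma> \<rightarrow>\<^sub>T \<sigma>) \<rightarrow>\<^sub>T \<sigma>) \<rightarrow>\<^sub>T (\<sigma> \<rightarrow>\<^sub>T \<sigma> \<rightarrow>\<^sub>T \<sigma>) \<rightarrow>\<^sub>T \<sigma> \<rightarrow>\<^sub>T \<sigma>)"
    "\<And>x y z. x \<in> obj M (\<sigma> \<rightarrow>\<^sub>T (\<sigma> \<rightarrow>\<^sub>T \<sigma>) \<rightarrow>\<^sub>T \<sigma>) \<Longrightarrow> y \<in> obj M (\<sigma> \<rightarrow>\<^sub>T \<sigma> \<rightarrow>\<^sub>T \<sigma>) \<Longrightarrow> z \<in> obj M \<sigma> \<Longrightarrow>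
       s \<bullet> x \<bullet> y \<bullet> z = x \<bullet> z \<bullet> (y \<bullet> z)"
    using S_exists[of \<sigma> "\<sigma> \<rightarrow>\<^sub>T \<sigma>" \<sigma>] by blast
  show thesis
  proof
    show "s \<bullet> k \<bullet> k' \<in> obj M (\<sigma> \<rightarrow>\<^sub>T \<sigma>)" using k k' s by (blast intro: app_closed)
    show "s \<bullet> k \<bullet> k' \<bullet> x = x" if "x \<in> obj M \<sigma>" for x
      using that k s k' app_closed by metis
  qed
qed

section \<open>Functions of environments that are represented by objects\<close>

abbreviation env :: "'v list \<Rightarrow> ty list \<Rightarrow> bool" where
  "env e \<Gamma> \<equiv> list_all2 (\<lambda>x \<sigma>. x \<in> obj M \<sigma>) e \<Gamma>"

text \<open>\<open>definable \<Gamma> \<tau> F\<close> says that \<open>F\<close>, restricted to environments for \<open>\<Gamma>\<close>, is the uncurried form of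
  an object of the model.\<close>

primrec definable :: "ty list \<Rightarrow> ty \<Rightarrow> ('v list \<Rightarrow> 'v) \<Rightarrow> bool" where
  "definable [] \<tau> F \<longleftrightarrow> F [] \<in> obj M \<tau>"
| "definable (\<sigma> # \<Gamma>) \<tau> F \<longleftrightarrow>
     (\<exists>G. definable \<Gamma> (\<sigma> \<rightarrow>\<^sub>T \<tau>) G \<and> (\<forall>e x. env e \<Gamma> \<longrightarrow> x \<in> obj M \<sigma> \<longrightarrow> G e \<bullet> x = F (x # e)))"

lemma definable_closed: "definable \<Gamma> \<tau> F \<Longrightarrow> env e \<Gamma> \<Longrightarrow> F e \<in> obj M \<tau>"
proof (induction \<Gamma> arbitrary: \<tau> F e)
  case (Cons \<sigma> \<Gamma>)
  then obtain G x e' where "definable \<Gamma> (\<sigma> \<rightarrow>\<^sub>T \<tau>) G" "e = x # e'" "x \<in> obj M \<sigma>" "env e' \<Gamma>"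
    "G e' \<bullet> x = F e"
    by (auto simp: list_all2_Cons2)
  then show ?case using Cons.IH app_closed by metis
qed simp

text \<open>The function occurs only in the outermost equation of \<open>definable\<close>; a case
  distinction on the context suffices, and the curried witness stays the same.\<close>

lemma definable_cong: "definable \<Gamma> \<tau> F \<Longrightarrow> (\<And>e. env e \<Gamma> \<Longrightarrow> F e = G e) \<Longrightarrow> definable \<Gamma> \<tau> G"
  by (cases \<Gamma>) auto

text \<open>K trades one entry of the context for an arrow: the constant \<open>c\<close> over
  \<open>\<sigma> # \<Gamma>\<close> is the uncurried form of the constant
  \<open>k \<bullet> c\<close> over \<Gamma>.\<close>

lemma definable_const: "c \<in> obj M \<tau> \<Longrightarrow> definable \<Gamma> \<tau> (\<lambda>_. c)"
proof (induction \<Gamma> arbitrary: \<tau> c)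
  case (Cons \<sigma> \<Gamma>)
  obtain k where "k \<in> obj M (\<tau> \<rightarrow>\<^sub>T \<sigma> \<rightarrow>\<^sub>T \<tau>)"
    "\<And>x y. x \<in> obj M \<tau> \<Longrightarrow> y \<in> obj M \<sigma> \<Longrightarrow> k \<bullet> x \<bullet> y = x"
    using K_exists[of \<tau> \<sigma>] by blast
  then show ?case using Cons.IH[of "k \<bullet> c" "\<sigma> \<rightarrow>\<^sub>T \<tau>"] Cons.prems app_closed by auto
qed simp

text \<open>S passes the innermost value to both function and argument, which reduces the claim to
  the shorter context with \<open>\<rho>\<close> moved into the types.\<close>

lemma definable_app:
  "definable \<Gamma> (\<sigma> \<rightarrow>\<^sub>T \<tau>) F \<Longrightarrow> definable \<Gamma> \<sigma> G \<Longrightarrow> definable \<Gamma> \<tau> (\<lambda>e. F e \<bullet> G e)"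
proof (induction \<Gamma> arbitrary: \<sigma> \<tau> F G)
  case Nil
  then show ?case by (auto intro: app_closed)
next
  case (Cons \<rho> \<Gamma>)
  then obtain F' G' where F': "definable \<Gamma> (\<rho> \<rightarrow>\<^sub>T \<sigma> \<rightarrow>\<^sub>T \<tau>) F'"
      "\<And>e x. env e \<Gamma> \<Longrightarrow> x \<in> obj M \<rho> \<Longrightarrow> F' e \<bullet> x = F (x # e)"
    and G': "definable \<Gamma> (\<rho> \<rightarrow>\<^sub>T \<sigma>) G'"
      "\<And>e x. env e \<Gamma> \<Longrightarrow> x \<in> obj M \<rho> \<Longrightarrow> G' e \<bullet> x = G (x # e)"
    by auto
  obtain s where s: "s \<in> obj M ((\<rho> \<rightarrow>\<^sub>T \<sigma> \<rightarrow>\<^sub>T \<tau>) \<rightarrow>\<^sub>T (\<rho> \<rightarrow>\<^sub>T \<sigma>) \<rightarrow>\<^sub>T \<rho> \<rightarrow>\<^sub>T \<tau>)"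
    "\<And>x y z. x \<in> obj M (\<rho> \<rightarrow>\<^sub>T \<sigma> \<rightarrow>\<^sub>T \<tau>) \<Longrightarrow> y \<in> obj M (\<rho> \<rightarrow>\<^sub>T \<sigma>) \<Longrightarrow> z \<in> obj M \<rho> \<Longrightarrow>
       s \<bullet> x \<bullet> y \<bullet> z = x \<bullet> z \<bullet> (y \<bullet> z)"
    using S_exists[of \<rho> \<sigma> \<tau>] by blast
  \<comment> \<open>The inner use of the induction hypothesis applies the constant \<open>s\<close>
    to \<open>F'\<close>, the outer one applies the result to \<open>G'\<close>.\<close>
  have "definable \<Gamma> (\<rho> \<rightarrow>\<^sub>T \<tau>) (\<lambda>e. s \<bullet> F' e \<bullet> G' e)"
    by (rule Cons.IH[OF Cons.IH[OF definable_const[OF s(1)] F'(1)] G'(1)])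
  moreover have "s \<bullet> F' e \<bullet> G' e \<bullet> x = F (x # e) \<bullet> G (x # e)" if "env e \<Gamma>" "x \<in> obj M \<rho>" for e x
    using s(2) F' G' that definable_closed by metis
  ultimately show ?case by auto
qed

text \<open>The innermost variable is given by the identity. Any other is a projection from the
  shorter context, followed by K, which discards the innermost value.\<close>

lemma definable_nth: "i < length \<Gamma> \<Longrightarrow> definable \<Gamma> (\<Gamma> ! i) (\<lambda>e. e ! i)"
proof (induction \<Gamma> arbitrary: i)
  case (Cons \<sigma> \<Gamma>)
  show ?case
  proof (cases i)
    case 0
    obtain j where "j \<in> obj M (\<sigma> \<rightarrow>\<^sub>T \<sigma>)" "\<And>x. x \<in> obj M \<sigma> \<Longrightarrow> j \<bullet> x = x" using I_exists[of \<sigma>] by blast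
    then show ?thesis using 0 definable_const[of j "\<sigma> \<rightarrow>\<^sub>T \<sigma>" \<Gamma>] by auto
  next
    case (Suc m)
    then have m: "m < length \<Gamma>" using Cons.prems by simp
    obtain k where k: "k \<in> obj M (\<Gamma> ! m \<rightarrow>\<^sub>T \<sigma> \<rightarrow>\<^sub>T \<Gamma> ! m)"
      "\<And>x y. x \<in> obj M (\<Gamma> ! m) \<Longrightarrow> y \<in> obj M \<sigma> \<Longrightarrow> k \<bullet> x \<bullet> y = x"
      using K_exists[of "\<Gamma> ! m" \<sigma>] by blast
    have "definable \<Gamma> (\<sigma> \<rightarrow>\<^sub>T \<Gamma> ! m) (\<lambda>e. k \<bullet> (e ! m))"
      by (rule definable_app[OF definable_const[OF k(1)] Cons.IH[OF m]])
    moreover have "k \<bullet> (e ! m) \<bullet> x = e ! m" if "env e \<Gamma>" "x \<in> obj M \<sigma>" for e x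
      using k(2) that m by (simp add: list_all2_conv_all_nth)
    ultimately show ?thesis using Suc by auto
  qed
qed simp

section \<open>Values of terms\<close>

text \<open>Uniqueness follows by extensionality, since every object of type \<open>N\<close> is a
  numeral.\<close>

lemma is_succ_The: "is_succ M (THE s. is_succ M s)"
proof -
  have "\<exists>s. is_succ M s" using T_model unfolding T_model_def by blast
  moreover have "s = s'" if "is_succ M s" "is_succ M s'" for s s'
    using that by (auto simp: is_succ_def obj_N intro!: extensionality[of s N N s'])
  ultimately show ?thesis by (metis theI')
qed

lemma is_rec_The: "is_rec M \<sigma> (THE r. is_rec M \<sigma> r)"
proof -
  have "\<exists>r. is_rec M \<sigma> r" using T_model unfolding T_model_def by blast
  moreover have "r = r'" if r: "is_rec M \<sigma> r" and r': "is_rec M \<sigma> r'" for r r'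
  proof (rule extensionality)
    show robj: "r \<in> obj M (\<sigma> \<rightarrow>\<^sub>T (N \<rightarrow>\<^sub>T \<sigma> \<rightarrow>\<^sub>T \<sigma>) \<rightarrow>\<^sub>T N \<rightarrow>\<^sub>T \<sigma>)"
      and r'obj: "r' \<in> obj M (\<sigma> \<rightarrow>\<^sub>T (N \<rightarrow>\<^sub>T \<sigma> \<rightarrow>\<^sub>T \<sigma>) \<rightarrow>\<^sub>T N \<rightarrow>\<^sub>T \<sigma>)"
      using r r' by (auto simp: is_rec_def)
    fix a assume a: "a \<in> obj M \<sigma>"
    show "r \<bullet> a = r' \<bullet> a"
    proof (rule extensionality)
      show "r \<bullet> a \<in> obj M ((N \<rightarrow>\<^sub>T \<sigma> \<rightarrow>\<^sub>T \<sigma>) \<rightarrow>\<^sub>T N \<rightarrow>\<^sub>T \<sigma>)"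
        "r' \<bullet> a \<in> obj M ((N \<rightarrow>\<^sub>T \<sigma> \<rightarrow>\<^sub>T \<sigma>) \<rightarrow>\<^sub>T N \<rightarrow>\<^sub>T \<sigma>)"
        using robj r'obj a by (auto intro: app_closed)
      fix f assume f: "f \<in> obj M (N \<rightarrow>\<^sub>T \<sigma> \<rightarrow>\<^sub>T \<sigma>)"
      show "r \<bullet> a \<bullet> f = r' \<bullet> a \<bullet> f"
      proof (rule extensionality)
        show "r \<bullet> a \<bullet> f \<in> obj M (N \<rightarrow>\<^sub>T \<sigma>)" "r' \<bullet> a \<bullet> f \<in> obj M (N \<rightarrow>\<^sub>T \<sigma>)"
          using robj r'obj a f by (blast intro: app_closed)+
        \<comment> \<open>After extensionality at all three arguments, the computation rules
          determine both recursors at every numeral.\<close>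
        have "r \<bullet> a \<bullet> f \<bullet> num M n = r' \<bullet> a \<bullet> f \<bullet> num M n" for n
          using r r' a f by (induction n) (simp_all add: is_rec_def)
        then show "r \<bullet> a \<bullet> f \<bullet> x = r' \<bullet> a \<bullet> f \<bullet> x" if "x \<in> obj M N" for x
          using that by (auto simp: obj_N)
      qed
    qed
  qed
  ultimately show ?thesis by (metis theI')
qed

text \<open>Values of abstractions are identified by exhibiting a candidate: extensionality and
  uniqueness of types leave at most one object that fits the description.\<close>

lemma sem_Lam_eqI:
  assumes "\<sigma> # \<Gamma> \<turnstile> t : \<tau>" "f \<in> obj M (\<sigma> \<rightarrow>\<^sub>T \<tau>)"
    "\<And>x. x \<in> obj M \<sigma> \<Longrightarrow> f \<bullet> x = sem M (\<sigma> # \<Gamma>) (x # e) t"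
  shows "sem M \<Gamma> e (Lam \<sigma> t) = f"
  unfolding sem.simps
proof (rule the_equality)
  show "\<exists>\<tau>. \<sigma> # \<Gamma> \<turnstile> t : \<tau> \<and> f \<in> obj M (\<sigma> \<rightarrow>\<^sub>T \<tau>) \<and>
    (\<forall>x \<in> obj M \<sigma>. f \<bullet> x = sem M (\<sigma> # \<Gamma>) (x # e) t)"
    using assms by blast
  fix g assume "\<exists>\<tau>. \<sigma> # \<Gamma> \<turnstile> t : \<tau> \<and> g \<in> obj M (\<sigma> \<rightarrow>\<^sub>T \<tau>) \<and>
    (\<forall>x \<in> obj M \<sigma>. g \<bullet> x = sem M (\<sigma> # \<Gamma>) (x # e) t)"
  then have "g \<in> obj M (\<sigma> \<rightarrow>\<^sub>T \<tau>)" "\<forall>x \<in> obj M \<sigma>. g \<bullet> x = sem M (\<sigma> # \<Gamma>) (x # e) t"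
    using typing_unique[OF assms(1)] by blast+
  then show "g = f" using assms extensionality[of g \<sigma> \<tau> f] by simp
qed

text \<open>This is bracket abstraction carried out in the model. It shows that the descriptions in
  \<open>sem\<close> denote objects, so that values of well-typed terms lie in the right
  carriers.\<close>

lemma definable_sem: "\<Gamma> \<turnstile> t : \<tau> \<Longrightarrow> definable \<Gamma> \<tau> (\<lambda>e. sem M \<Gamma> e t)"
proof (induction rule: typing.induct)
  case (Var i \<Gamma>)
  then show ?case by (simp add: definable_nth)
next
  case (Lam \<sigma> \<Gamma> t \<tau>)
  \<comment> \<open>The induction hypothesis for \<open>\<sigma> # \<Gamma>\<close> supplies the
    curried function directly; \<open>G e\<close> is the object that the description of the
    abstraction asks for.\<close>
  then obtain G where G: "definable \<Gamma> (\<sigma> \<rightarrow>\<^sub>T \<tau>) G"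
    "\<And>e x. env e \<Gamma> \<Longrightarrow> x \<in> obj M \<sigma> \<Longrightarrow> G e \<bullet> x = sem M (\<sigma> # \<Gamma>) (x # e) t"
    by auto
  show ?case
    by (rule definable_cong[OF G(1)], rule sem_Lam_eqI[symmetric])
      (use Lam.hyps G definable_closed in auto)
next
  case (App \<Gamma> t \<sigma> \<tau> u)
  then show ?case by (simp add: definable_app)
next
  case (Zero \<Gamma>)
  show ?case by (simp add: definable_const obj_N)
next
  case (Succ \<Gamma>)
  show ?case using is_succ_The definable_const unfolding sem.simps is_succ_def by blast
next
  case (Rec \<Gamma> \<sigma>)
  show ?case using is_rec_The[of \<sigma>] definable_const unfolding sem.simps is_rec_def by blast
qed

lemma sem_closed: "\<Gamma> \<turnstile> t : \<tau> \<Longrightarrow> env e \<Gamma> \<Longrightarrow> sem M \<Gamma> e t \<in> obj M \<tau>"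
  using definable_closed definable_sem by blast

text \<open>The beta rule of the semantics, which replaces the definite description in all later
  computations.\<close>

lemma sem_Lam_app:
  assumes t: "\<sigma> # \<Gamma> \<turnstile> t : \<tau>" and e: "env e \<Gamma>" and x: "x \<in> obj M \<sigma>"
  shows "sem M \<Gamma> e (Lam \<sigma> t) \<bullet> x = sem M (\<sigma> # \<Gamma>) (x # e) t"
proof -
  from definable_sem[OF t] obtain G where G: "definable \<Gamma> (\<sigma> \<rightarrow>\<^sub>T \<tau>) G"
    "\<And>x. x \<in> obj M \<sigma> \<Longrightarrow> G e \<bullet> x = sem M (\<sigma> # \<Gamma>) (x # e) t"
    using e by auto
  then have "sem M \<Gamma> e (Lam \<sigma> t) = G e"
    using sem_Lam_eqI[OF t definable_closed[OF G(1) e]] by blast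
  then show ?thesis using G(2) x by simp
qed

text \<open>Only the entries for \<Gamma> are looked up, whatever is appended. Hence closed terms
  have the same value everywhere, as needed for \<open>\<eta>\<close>, \<open>\<kappa>\<close> and
  \<open>ke\<close> below binders.\<close>

lemma sem_append:
  "\<Gamma> \<turnstile> t : \<tau> \<Longrightarrow> env e \<Gamma> \<Longrightarrow> sem M (\<Gamma> @ \<Delta>) (e @ d) t = sem M \<Gamma> e t"
proof (induction arbitrary: e rule: typing.induct)
  case (Var i \<Gamma>)
  then show ?case by (auto simp: nth_append dest: list_all2_lengthD)
next
  case (Lam \<sigma> \<Gamma> t \<tau>)
  show ?case
  \<comment> \<open>The two descriptions mention different contexts, so the value in the short
    context is checked to satisfy the description for the long one.\<close>
  proof (rule sem_Lam_eqI)
    show "\<sigma> # \<Gamma> @ \<Delta> \<turnstile> t : \<tau>" using typing_append[OF Lam.hyps] by simp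
    show "sem M \<Gamma> e (Lam \<sigma> t) \<in> obj M (\<sigma> \<rightarrow>\<^sub>T \<tau>)"
      using sem_closed typing.Lam Lam by blast
    show "sem M \<Gamma> e (Lam \<sigma> t) \<bullet> x = sem M (\<sigma> # \<Gamma> @ \<Delta>) (x # e @ d) t" if "x \<in> obj M \<sigma>" for x
      using Lam.IH[of "x # e"] sem_Lam_app[OF Lam.hyps Lam.prems that] Lam.prems that by simp
  qed
qed simp_all

lemma sem_value_of: "[] \<turnstile> t : \<tau> \<Longrightarrow> sem M \<Gamma> e t = value_of M t"
  using sem_append[of "[]" t \<tau> "[]" \<Gamma> e] by simp

end

section \<open>The logical relation\<close>

locale nucleus_relation = T_structure M for M :: "'v type_structure" +
  fixes JN :: ty and \<eta> \<kappa> :: tm and R :: "('v \<times> 'v) set"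
  assumes nucleus: "nucleus JN \<eta> \<kappa>"
    and R_obj: "R \<subseteq> obj M N \<times> obj M JN"
    and eta_rel: "n \<in> obj M N \<Longrightarrow> (n, value_of M \<eta> \<bullet> n) \<in> R"
    and kappa_rel: "f \<in> obj M (N \<rightarrow>\<^sub>T N) \<Longrightarrow> g \<in> obj M (N \<rightarrow>\<^sub>T JN) \<Longrightarrow>
      (\<And>n. n \<in> obj M N \<Longrightarrow> (f \<bullet> n, g \<bullet> n) \<in> R) \<Longrightarrow>
      (f, value_of M \<kappa> \<bullet> g) \<in> logical_relation M JN R (N \<rightarrow>\<^sub>T N)"
begin

abbreviation LR where "LR \<equiv> logical_relation M JN R"
abbreviation J where "J \<equiv> Jty JN"

lemma typing_eta: "[] \<turnstile> \<eta> : N \<rightarrow>\<^sub>T JN"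
  and typing_kappa: "[] \<turnstile> \<kappa> : (N \<rightarrow>\<^sub>T JN) \<rightarrow>\<^sub>T JN \<rightarrow>\<^sub>T JN"
  using nucleus unfolding nucleus_def by auto

text \<open>At arrow types membership in the carriers is part of the relation; at \<open>N\<close>
  it comes from \<open>R_obj\<close>.\<close>

lemma LR_obj: "(x, a) \<in> LR \<sigma> \<Longrightarrow> x \<in> obj M \<sigma> \<and> a \<in> obj M (J \<sigma>)"
  using R_obj by (cases \<sigma>) auto

lemma LR_ArrowI:
  assumes "f \<in> obj M (\<sigma> \<rightarrow>\<^sub>T \<tau>)" "g \<in> obj M (J \<sigma> \<rightarrow>\<^sub>T J \<tau>)"
    "\<And>x a. (x, a) \<in> LR \<sigma> \<Longrightarrow> (f \<bullet> x, g \<bullet> a) \<in> LR \<tau>"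
  shows "(f, g) \<in> LR (\<sigma> \<rightarrow>\<^sub>T \<tau>)"
  using assms by auto

lemma LR_app: "(f, g) \<in> LR (\<sigma> \<rightarrow>\<^sub>T \<tau>) \<Longrightarrow> (x, a) \<in> LR \<sigma> \<Longrightarrow> (f \<bullet> x, g \<bullet> a) \<in> LR \<tau>"
  using LR_obj[of x a \<sigma>] by auto

section \<open>Extending the hypothesis on \<kappa> to all types\<close>

lemma value_of_ke: "value_of M (ke JN \<kappa> \<sigma>) \<in> obj M ((N \<rightarrow>\<^sub>T J \<sigma>) \<rightarrow>\<^sub>T JN \<rightarrow>\<^sub>T J \<sigma>)"
  using sem_closed[OF typing_ke[OF typing_kappa]] by simp

text \<open>The defining equation of \<open>ke\<close> at an arrow type, with \<open>h\<close> as
  the object named by the inner abstraction over \<open>n\<close>.\<close>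

lemma ke_Arrow_app:
  assumes g: "g \<in> obj M (N \<rightarrow>\<^sub>T J \<sigma> \<rightarrow>\<^sub>T J \<tau>)" and a: "a \<in> obj M JN" and x: "x \<in> obj M (J \<sigma>)"
  obtains h where "h \<in> obj M (N \<rightarrow>\<^sub>T J \<tau>)" "\<And>n. n \<in> obj M N \<Longrightarrow> h \<bullet> n = g \<bullet> n \<bullet> x"
    "value_of M (ke JN \<kappa> (\<sigma> \<rightarrow>\<^sub>T \<tau>)) \<bullet> g \<bullet> a \<bullet> x = value_of M (ke JN \<kappa> \<tau>) \<bullet> h \<bullet> a"
proof -
  let ?G = "N \<rightarrow>\<^sub>T J \<sigma> \<rightarrow>\<^sub>T J \<tau>"
  let ?\<Gamma> = "[J \<sigma>, JN, ?G]"
  let ?t = "Var 3 \<cdot> Var 0 \<cdot> Var 1"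
  let ?b = "ke JN \<kappa> \<tau> \<cdot> Lam N ?t \<cdot> Var 1"
  \<comment> \<open>The innermost value comes first. Below the further binder for \<open>n\<close>,
    the indices 0, 1 and 3 therefore denote \<open>n\<close>, \<open>x\<close> and
    \<open>g\<close>.\<close>
  define h where "h = sem M ?\<Gamma> [x, a, g] (Lam N ?t)"
  have e: "env [x, a, g] ?\<Gamma>" using assms by simp
  have t: "N # ?\<Gamma> \<turnstile> ?t : J \<tau>" by (rule typing.App typing_Var | simp)+
  note b = typing_ke_body[OF typing_ke[OF typing_kappa, of \<tau>], of "J \<sigma>"]
  show thesis
  proof
    show "h \<in> obj M (N \<rightarrow>\<^sub>T J \<tau>)" unfolding h_def by (rule sem_closed[OF typing.Lam[OF t] e])
    show "h \<bullet> n = g \<bullet> n \<bullet> x" if "n \<in> obj M N" for n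
      using sem_Lam_app[OF t e that] unfolding h_def by simp
    have "value_of M (ke JN \<kappa> (\<sigma> \<rightarrow>\<^sub>T \<tau>)) \<bullet> g \<bullet> a \<bullet> x = sem M ?\<Gamma> [x, a, g] ?b"
      unfolding ke.simps
      using sem_Lam_app[OF typing.Lam[OF typing.Lam[OF b]], of "[]" g]
        sem_Lam_app[OF typing.Lam[OF b], of "[g]" a] sem_Lam_app[OF b, of "[a, g]" x] assms
      by (simp del: sem.simps)
    also have "\<dots> = value_of M (ke JN \<kappa> \<tau>) \<bullet> h \<bullet> a"
      unfolding h_def sem.simps(3) sem_value_of[OF typing_ke[OF typing_kappa], of ?\<Gamma>]
      by (simp del: sem.simps add: sem.simps(1))
    finally show "value_of M (ke JN \<kappa> (\<sigma> \<rightarrow>\<^sub>T \<tau>)) \<bullet> g \<bullet> a \<bullet> x = value_of M (ke JN \<kappa> \<tau>) \<bullet> h \<bullet> a" .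
  qed
qed

text \<open>Counterpart of \<open>h\<close> for the untranslated side. Here \<open>f\<close> is an
  arbitrary object and not the value of a term, so combinatory completeness is used with
  \<open>f\<close> and \<open>x\<close> as constants.\<close>

lemma flip_exists:
  assumes f: "f \<in> obj M (\<rho> \<rightarrow>\<^sub>T \<sigma> \<rightarrow>\<^sub>T \<tau>)" and x: "x \<in> obj M \<sigma>"
  obtains h where "h \<in> obj M (\<rho> \<rightarrow>\<^sub>T \<tau>)" "\<And>z. z \<in> obj M \<rho> \<Longrightarrow> h \<bullet> z = f \<bullet> z \<bullet> x"
proof -
  have "definable [\<rho>] \<rho> (\<lambda>e. e ! 0)" using definable_nth[of 0 "[\<rho>]"] by simp
  then have "definable [\<rho>] \<tau> (\<lambda>e. f \<bullet> e ! 0 \<bullet> x)"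
    using definable_app definable_const f x by blast
  then show thesis using that by auto
qed

text \<open>At an arrow type, fixing related arguments \<open>x\<close> and \<open>b\<close> turns
  the two sequences into sequences at the result type, where the induction hypothesis
  applies.\<close>

lemma ke_rel:
  assumes "f \<in> obj M (N \<rightarrow>\<^sub>T \<sigma>)" "g \<in> obj M (N \<rightarrow>\<^sub>T J \<sigma>)"
    "\<And>n. n \<in> obj M N \<Longrightarrow> (f \<bullet> n, g \<bullet> n) \<in> LR \<sigma>"
  shows "(f, value_of M (ke JN \<kappa> \<sigma>) \<bullet> g) \<in> LR (N \<rightarrow>\<^sub>T \<sigma>)"
  using assms
proof (induction \<sigma> arbitrary: f g)
  case N
  then show ?case using kappa_rel[of f g] by (simp del: logical_relation.simps(2))
next
  case (Arrow \<sigma> \<tau>)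
  have k: "value_of M (ke JN \<kappa> (\<sigma> \<rightarrow>\<^sub>T \<tau>)) \<bullet> g \<in> obj M (JN \<rightarrow>\<^sub>T J (\<sigma> \<rightarrow>\<^sub>T \<tau>))"
    using app_closed[OF value_of_ke Arrow.prems(2)] .
  show ?case
  proof (rule LR_ArrowI)
    show "f \<in> obj M (N \<rightarrow>\<^sub>T \<sigma> \<rightarrow>\<^sub>T \<tau>)" by fact
    show "value_of M (ke JN \<kappa> (\<sigma> \<rightarrow>\<^sub>T \<tau>)) \<bullet> g \<in> obj M (J N \<rightarrow>\<^sub>T J (\<sigma> \<rightarrow>\<^sub>T \<tau>))" using k by simp
    fix n a assume na: "(n, a) \<in> LR N"
    then have n: "n \<in> obj M N" and a: "a \<in> obj M JN" using LR_obj[OF na] by auto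
    show "(f \<bullet> n, value_of M (ke JN \<kappa> (\<sigma> \<rightarrow>\<^sub>T \<tau>)) \<bullet> g \<bullet> a) \<in> LR (\<sigma> \<rightarrow>\<^sub>T \<tau>)"
    proof (rule LR_ArrowI)
      show "f \<bullet> n \<in> obj M (\<sigma> \<rightarrow>\<^sub>T \<tau>)" using app_closed[OF Arrow.prems(1) n] .
      show "value_of M (ke JN \<kappa> (\<sigma> \<rightarrow>\<^sub>T \<tau>)) \<bullet> g \<bullet> a \<in> obj M (J \<sigma> \<rightarrow>\<^sub>T J \<tau>)"
        using app_closed[OF k a] unfolding Jty.simps .
      fix x b assume xb: "(x, b) \<in> LR \<sigma>"
      then have x: "x \<in> obj M \<sigma>" and b: "b \<in> obj M (J \<sigma>)" using LR_obj[OF xb] by auto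
      obtain f' where f': "f' \<in> obj M (N \<rightarrow>\<^sub>T \<tau>)" "\<And>m. m \<in> obj M N \<Longrightarrow> f' \<bullet> m = f \<bullet> m \<bullet> x"
        using flip_exists[OF Arrow.prems(1) x] by blast
      obtain h where h: "h \<in> obj M (N \<rightarrow>\<^sub>T J \<tau>)" "\<And>m. m \<in> obj M N \<Longrightarrow> h \<bullet> m = g \<bullet> m \<bullet> b"
        "value_of M (ke JN \<kappa> (\<sigma> \<rightarrow>\<^sub>T \<tau>)) \<bullet> g \<bullet> a \<bullet> b = value_of M (ke JN \<kappa> \<tau>) \<bullet> h \<bullet> a"
        using ke_Arrow_app[OF Arrow.prems(2)[unfolded Jty.simps] a b] by blast
      have "(f' \<bullet> m, h \<bullet> m) \<in> LR \<tau>" if "m \<in> obj M N" for m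
        using LR_app[OF Arrow.prems(3)[OF that] xb] f'(2) h(2) that by simp
      \<comment> \<open>Applied to the related pair \<open>n\<close>, \<open>a\<close>, the
        hypothesis at \<open>\<tau>\<close> yields exactly the two required values, by the equations
        for \<open>f'\<close> and \<open>h\<close>.\<close>
      from LR_app[OF Arrow.IH(2)[OF f'(1) h(1) this] na]
      show "(f \<bullet> n \<bullet> x, value_of M (ke JN \<kappa> (\<sigma> \<rightarrow>\<^sub>T \<tau>)) \<bullet> g \<bullet> a \<bullet> b) \<in> LR \<tau>"
        using f'(2)[OF n] h(3) by simp
    qed
  qed
qed

section \<open>Successor and recursor\<close>

text \<open>An instance of the hypothesis on \<kappa>: the successor and \<eta> composed with it are
  pointwise related by the hypothesis on \<eta>, taken at the successor of \<open>n\<close>.\<close>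

lemma Succ_rel:
  assumes d: "env d \<Delta>"
  shows "(value_of M Succ, sem M \<Delta> d (Jtm JN \<eta> \<kappa> Succ)) \<in> LR (N \<rightarrow>\<^sub>T N)"
proof -
  let ?t = "\<eta> \<cdot> (Succ \<cdot> Var 0)"
  let ?g = "sem M \<Delta> d (Lam N ?t)"
  have t: "N # \<Delta> \<turnstile> ?t : JN"
    by (rule typing.App[OF typing_closed[OF typing_eta]] typing.App[OF typing.Succ] typing_Var | simp)+
  have s: "value_of M Succ \<in> obj M (N \<rightarrow>\<^sub>T N)" using sem_closed[OF typing.Succ] by blast
  have "(value_of M Succ \<bullet> n, ?g \<bullet> n) \<in> R" if n: "n \<in> obj M N" for n
  proof -
    have "?g \<bullet> n = value_of M \<eta> \<bullet> (value_of M Succ \<bullet> n)"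
      unfolding sem_Lam_app[OF t d n] by (simp add: sem_value_of[OF typing_eta, of "N # \<Delta>"])
    then show ?thesis using eta_rel[OF app_closed[OF s n]] by simp
  qed
  from kappa_rel[OF s sem_closed[OF typing.Lam[OF t] d] this]
  show ?thesis by (simp only: Jtm.simps sem.simps(3) sem_value_of[OF typing_kappa, of \<Delta> d])
qed

text \<open>For related \<open>x\<close>, \<open>a\<close> and \<open>f\<close>, \<open>g\<close>
  both sides are functions of the recursion argument, and \<open>ke_rel\<close> reduces their
  relatedness to that of two recursive sequences.\<close>

lemma Rec_rel:
  assumes d: "env d \<Delta>"
  shows "(value_of M (Rec \<sigma>), sem M \<Delta> d (Jtm JN \<eta> \<kappa> (Rec \<sigma>))) \<in>
    LR (\<sigma> \<rightarrow>\<^sub>T (N \<rightarrow>\<^sub>T \<sigma> \<rightarrow>\<^sub>T \<sigma>) \<rightarrow>\<^sub>T N \<rightarrow>\<^sub>T \<sigma>)"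
proof -
  let ?F = "JN \<rightarrow>\<^sub>T J \<sigma> \<rightarrow>\<^sub>T J \<sigma>"
  let ?t = "Var 1 \<cdot> (\<eta> \<cdot> Var 0)"
  let ?b = "ke JN \<kappa> \<sigma> \<cdot> (Rec (J \<sigma>) \<cdot> Var 1 \<cdot> Lam N ?t)"
  let ?r = "value_of M (Rec \<sigma>)" and ?r' = "value_of M (Rec (J \<sigma>))"
  let ?L = "sem M \<Delta> d (Lam (J \<sigma>) (Lam ?F ?b))"
  have t: "N # ?F # J \<sigma> # \<Delta> \<turnstile> ?t : J \<sigma> \<rightarrow>\<^sub>T J \<sigma>"
    by (rule typing.App[OF typing_closed[OF typing_eta]] typing.App typing_Var | simp)+
  have b: "?F # J \<sigma> # \<Delta> \<turnstile> ?b : JN \<rightarrow>\<^sub>T J \<sigma>"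
    by (rule typing.App[OF typing_closed[OF typing_ke[OF typing_kappa]]] typing.App typing.Rec
        typing.Lam[OF t] typing_Var | simp)+
  have r: "is_rec M \<sigma> ?r" "is_rec M (J \<sigma>) ?r'" using is_rec_The by simp_all
  then have robj: "?r \<in> obj M (\<sigma> \<rightarrow>\<^sub>T (N \<rightarrow>\<^sub>T \<sigma> \<rightarrow>\<^sub>T \<sigma>) \<rightarrow>\<^sub>T N \<rightarrow>\<^sub>T \<sigma>)"
    "?r' \<in> obj M (J \<sigma> \<rightarrow>\<^sub>T (N \<rightarrow>\<^sub>T J \<sigma> \<rightarrow>\<^sub>T J \<sigma>) \<rightarrow>\<^sub>T N \<rightarrow>\<^sub>T J \<sigma>)"
    by (simp_all only: is_rec_def)
  have Lobj: "?L \<in> obj M (J \<sigma> \<rightarrow>\<^sub>T ?F \<rightarrow>\<^sub>T JN \<rightarrow>\<^sub>T J \<sigma>)"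
    using sem_closed[OF typing.Lam[OF typing.Lam[OF b]] d] .
  have "(?r, ?L) \<in> LR (\<sigma> \<rightarrow>\<^sub>T (N \<rightarrow>\<^sub>T \<sigma> \<rightarrow>\<^sub>T \<sigma>) \<rightarrow>\<^sub>T N \<rightarrow>\<^sub>T \<sigma>)"
  proof (rule LR_ArrowI[OF robj(1)])
    show "?L \<in> obj M (J \<sigma> \<rightarrow>\<^sub>T J ((N \<rightarrow>\<^sub>T \<sigma> \<rightarrow>\<^sub>T \<sigma>) \<rightarrow>\<^sub>T N \<rightarrow>\<^sub>T \<sigma>))" using Lobj by (simp del: sem.simps)
    fix x a assume xa: "(x, a) \<in> LR \<sigma>"
    then have x: "x \<in> obj M \<sigma>" and a: "a \<in> obj M (J \<sigma>)" using LR_obj[OF xa] by auto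
    show "(?r \<bullet> x, ?L \<bullet> a) \<in> LR ((N \<rightarrow>\<^sub>T \<sigma> \<rightarrow>\<^sub>T \<sigma>) \<rightarrow>\<^sub>T N \<rightarrow>\<^sub>T \<sigma>)"
    proof (rule LR_ArrowI[OF app_closed[OF robj(1) x]])
      show "?L \<bullet> a \<in> obj M (J (N \<rightarrow>\<^sub>T \<sigma> \<rightarrow>\<^sub>T \<sigma>) \<rightarrow>\<^sub>T J (N \<rightarrow>\<^sub>T \<sigma>))"
        using app_closed[OF Lobj a] by (simp del: sem.simps)
      fix f g assume fg: "(f, g) \<in> LR (N \<rightarrow>\<^sub>T \<sigma> \<rightarrow>\<^sub>T \<sigma>)"
      then have f: "f \<in> obj M (N \<rightarrow>\<^sub>T \<sigma> \<rightarrow>\<^sub>T \<sigma>)" and g: "g \<in> obj M ?F" using LR_obj[OF fg] by auto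
      let ?e = "g # a # d" and ?\<Gamma> = "?F # J \<sigma> # \<Delta>"
      have e: "env ?e ?\<Gamma>" using d a g by simp
      \<comment> \<open>\<open>h\<close> is \<open>g\<close> composed with \<open>\<eta>\<close>,
        the step function of the translated recursion.\<close>
      define h where "h = sem M ?\<Gamma> ?e (Lam N ?t)"
      have h: "h \<in> obj M (N \<rightarrow>\<^sub>T J \<sigma> \<rightarrow>\<^sub>T J \<sigma>)"
        unfolding h_def by (rule sem_closed[OF typing.Lam[OF t] e])
      have h_app: "h \<bullet> n = g \<bullet> (value_of M \<eta> \<bullet> n)" if "n \<in> obj M N" for n
        unfolding h_def sem_Lam_app[OF t e that]
        by (simp add: sem_value_of[OF typing_eta, of "N # ?\<Gamma>"])
      have "?L \<bullet> a \<bullet> g = sem M ?\<Gamma> ?e ?b"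
        using sem_Lam_app[OF typing.Lam[OF b] d a] sem_Lam_app[OF b, of "a # d" g] d a g
        by (simp del: sem.simps)
      also have "\<dots> = value_of M (ke JN \<kappa> \<sigma>) \<bullet> (?r' \<bullet> a \<bullet> h)"
        unfolding h_def sem.simps(3) sem_value_of[OF typing_ke[OF typing_kappa], of ?\<Gamma>]
          sem_value_of[OF typing.Rec, of ?\<Gamma>]
        by (simp del: sem.simps add: sem.simps(1))
      finally have L: "?L \<bullet> a \<bullet> g = value_of M (ke JN \<kappa> \<sigma>) \<bullet> (?r' \<bullet> a \<bullet> h)" .
      \<comment> \<open>The base case is the relation of \<open>x\<close> and \<open>a\<close>. In
        the successor case \<open>f\<close> at \<open>n\<close> meets \<open>g\<close> at
        \<open>\<eta>\<close> of \<open>n\<close>, and the latter is \<open>h\<close> at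
        \<open>n\<close>.\<close>
      have "(?r \<bullet> x \<bullet> f \<bullet> num M n, ?r' \<bullet> a \<bullet> h \<bullet> num M n) \<in> LR \<sigma>" for n
      proof (induction n)
        case 0
        show ?case using r x f a h xa unfolding is_rec_def by simp
      next
        case (Suc n)
        have n: "num M n \<in> obj M N" by (simp add: obj_N)
        then have "(num M n, value_of M \<eta> \<bullet> num M n) \<in> LR N" using eta_rel by simp
        from LR_app[OF LR_app[OF fg this] Suc] show ?case
          using r x f a h h_app[OF n] unfolding is_rec_def by simp
      qed
      then have *: "(?r \<bullet> x \<bullet> f \<bullet> n, ?r' \<bullet> a \<bullet> h \<bullet> n) \<in> LR \<sigma>" if "n \<in> obj M N" for n
        using that by (auto simp: obj_N simp del: sem.simps)
      show "(?r \<bullet> x \<bullet> f, ?L \<bullet> a \<bullet> g) \<in> LR (N \<rightarrow>\<^sub>T \<sigma>)"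
        unfolding L
        by (rule ke_rel[OF app_closed[OF app_closed[OF robj(1) x] f]
              app_closed[OF app_closed[OF robj(2) a] h] *])
    qed
  qed
  then show ?thesis by (simp only: Jtm.simps)
qed

section \<open>Induction on typing derivations\<close>

text \<open>One list of related pairs carries both environments: first components for the term,
  second components for its translation.\<close>

lemma fundamental:
  assumes "\<Gamma> \<turnstile> t : \<rho>" "list_all2 (\<lambda>p \<sigma>. p \<in> LR \<sigma>) ps \<Gamma>"
  shows "(sem M \<Gamma> (map fst ps) t, sem M (map J \<Gamma>) (map snd ps) (Jtm JN \<eta> \<kappa> t)) \<in> LR \<rho>"
proof -
  have env: "env (map fst ps) \<Gamma> \<and> env (map snd ps) (map J \<Gamma>)"
    if "list_all2 (\<lambda>p \<sigma>. p \<in> LR \<sigma>) ps \<Gamma>" for ps \<Gamma>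
    using that by (induction rule: list_all2_induct) (use LR_obj in fastforce)+
  show ?thesis using assms
  proof (induction arbitrary: ps rule: typing.induct)
    case (Var i \<Gamma>)
    then show ?case by (simp add: list_all2_conv_all_nth)
  next
    case (Lam \<sigma> \<Gamma> t \<tau>)
    let ?e = "map fst ps" and ?d = "map snd ps"
    have e: "env ?e \<Gamma>" and d: "env ?d (map J \<Gamma>)" using env[OF Lam.prems] by auto
    note t' = typing_Jtm[OF nucleus Lam.hyps, unfolded list.map]
    show ?case unfolding Jtm.simps
    proof (rule LR_ArrowI)
      show "sem M \<Gamma> ?e (Lam \<sigma> t) \<in> obj M (\<sigma> \<rightarrow>\<^sub>T \<tau>)" by (rule sem_closed[OF typing.Lam[OF Lam.hyps] e])
      show "sem M (map J \<Gamma>) ?d (Lam (J \<sigma>) (Jtm JN \<eta> \<kappa> t)) \<in> obj M (J \<sigma> \<rightarrow>\<^sub>T J \<tau>)"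
        by (rule sem_closed[OF typing.Lam[OF t'] d])
      fix x a assume xa: "(x, a) \<in> LR \<sigma>"
      show "(sem M \<Gamma> ?e (Lam \<sigma> t) \<bullet> x, sem M (map J \<Gamma>) ?d (Lam (J \<sigma>) (Jtm JN \<eta> \<kappa> t)) \<bullet> a) \<in> LR \<tau>"
        \<comment> \<open>By the beta rule on both sides the goal is about the two bodies, in
          environments extended by the related pair.\<close>
        using Lam.IH[of "(x, a) # ps"] Lam.prems xa LR_obj[OF xa]
          sem_Lam_app[OF Lam.hyps e, of x] sem_Lam_app[OF t' d, of a]
        by (simp del: sem.simps)
    qed
  next
    case (App \<Gamma> t \<sigma> \<tau> u)
    then show ?case using LR_app[OF App.IH] by simp
  next
    case (Zero \<Gamma>)
    show ?case using eta_rel by (simp add: sem_value_of[OF typing_eta, of "map J \<Gamma>"] obj_N)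
  next
    case (Succ \<Gamma>)
    then show ?case
      using Succ_rel env unfolding sem_value_of[OF typing.Succ, of \<Gamma>] by blast
  next
    case (Rec \<Gamma> \<sigma>)
    then show ?case
      using Rec_rel env unfolding sem_value_of[OF typing.Rec, of \<Gamma>] by blast
  qed
qed

end

theorem theorem3:
  fixes M :: "'v type_structure" and JN :: ty and \<eta> \<kappa> :: tm and R :: "('v \<times> 'v) set"
  assumes "T_model M"
    and "nucleus JN \<eta> \<kappa>"
    and "R \<subseteq> obj M N \<times> obj M JN"
    and "\<forall>n \<in> obj M N. (n, app M (value_of M \<eta>) n) \<in> R"
    and "\<forall>f \<in> obj M (N \<rightarrow>\<^sub>T N). \<forall>g \<in> obj M (N \<rightarrow>\<^sub>T JN).
           (\<forall>n \<in> obj M N. (app M f n, app M g n) \<in> R) \<longrightarrow>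
           (f, app M (value_of M \<kappa>) g) \<in> logical_relation M JN R (N \<rightarrow>\<^sub>T N)"
  shows "\<forall>t \<rho>. [] \<turnstile> t : \<rho> \<longrightarrow>
           (value_of M t, value_of M (Jtm JN \<eta> \<kappa> t)) \<in> logical_relation M JN R \<rho>"
proof -
  interpret nucleus_relation M JN \<eta> \<kappa> R
    by unfold_locales (use assms in blast)+
  \<comment> \<open>For a closed term the empty list of pairs serves as related
    environments.\<close>
  show ?thesis using fundamental[of "[]" _ _ "[]"] by simp
qed

end
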